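(* Let $n,k\ge 0$ be integers, let $[p,q]$ be a compact real interval, let $x,x_0,x_1,\dots,x_n\in[p,q]$ be distinct numbers, and let $f\in C^{n+k+1}[p,q]$. With $N_r(x)$, $\tilde N^{(k)}_{0,1,\dots,n}[x]$, $A_r(x)$, $\tilde A^{(k)}_{0,1,\dots,n}[x]$ as defined in the context, for some $\xi$ in the smallest closed interval containing $x,x_0,\dots,x_n$: (i) $$\frac{f^{(k)}(x)}{k!}+\frac{f^{(k-1)}(x)}{(k-1)!}N_1(x)+\dots+\frac{f(x)}{0!}N_k(x)=\tilde N^{(k)}_{0,1,\dots,n}[x]+\frac{f^{(n+k+1)}(\xi)}{(n+k+1)!}\prod_{i=0}^{n}(x-x_i);$$ (ii) $$\frac{f^{(k)}(x)}{k!}+\frac{f^{(k-1)}(x)}{(k-1)!}A_1(x)+\dots+\frac{f(x)}{0!}A_k(x)=\tilde A^{(k)}_{0,1,\dots,n}[x]+\frac{f^{(n+k+1)}(\xi)}{(n+k+1)!}\prod_{i=0}^{n}(x-x_i).$$ (For $k=0$ the left-hand sides are just $f(x)$.)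
   Context: For an integer $r\ge 0$ define the following quantities, where vertical bars denote $2\times2$ determinants. Neville scheme: for $j=0,\dots,n$ put $N^{(r)}_j[x]=\dfrac{1}{(x_j-x)^r}$ and $\tilde N^{(r)}_j[x]=\dfrac{f(x_j)}{(x_j-x)^r}$. For $i=1,\dots,n$ and $j=0,\dots,n-i$ put $$N^{(r)}_{j,j+1,\dots,i+j}[x]=\frac{1}{x_{i+j}-x_j}\begin{vmatrix} N^{(r)}_{j,j+1,\dots,i+j-1}[x] & x_j-x\\ N^{(r)}_{j+1,j+2,\dots,i+j}[x] & x_{i+j}-x\end{vmatrix},$$ and define $\tilde N^{(r)}_{j,j+1,\dots,i+j}[x]$ by the same recursion with $\tilde N$ in place of $N$. Set $N_r(x)=N^{(r)}_{0,1,\dots,n}[x]$. Aitken scheme: for $j=0,\dots,n$ put $A^{(r)}_j[x]=\dfrac{1}{(x_j-x)^r}$ and $\tilde A^{(r)}_j[x]=\dfrac{f(x_j)}{(x_j-x)^r}$. For $i=0,\dots,n-1$ and $j=i+1,\dots,n$ put $$A^{(r)}_{0,1,\dots,i-1,i,j}[x]=\frac{1}{x_j-x_i}\begin{vmatrix} A^{(r)}_{0,1,\dots,i-1,i}[x] & x_i-x\\ A^{(r)}_{0,1,\dots,i-1,j}[x] & x_j-x\end{vmatrix}$$ (for $i=0$ the first column consists of $A^{(r)}_0[x]$ and $A^{(r)}_j[x]$), and define $\tilde A^{(r)}_{0,1,\dots,i,j}[x]$ by the same recursion with $\tilde A$ in place of $A$. Set $A_r(x)=A^{(r)}_{0,1,\dots,n}[x]$.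 *)

theory Defs
  imports "HOL-Analysis.Analysis"
begin

abbreviation det2 :: "real \<Rightarrow> real \<Rightarrow> real \<Rightarrow> real \<Rightarrow> real" where
  "det2 a b c d \<equiv> det (vector [vector [a, b], vector [c, d]] :: real^2^2)"

text \<open>
  The derivatives are taken within \<open>S\<close>, so on a compact interval they are
  one-sided at the end points. They depend only on the values of \<open>f\<close> on \<open>S\<close>
  as long as they are evaluated at points of \<open>S\<close>.
\<close>

definition higher_deriv_on :: "real set \<Rightarrow> nat \<Rightarrow> (real \<Rightarrow> real) \<Rightarrow> real \<Rightarrow> real" where
  "higher_deriv_on S m f = ((\<lambda>g t. vector_derivative g (at t within S)) ^^ m) f"

definition C_on :: "nat \<Rightarrow> real set \<Rightarrow> (real \<Rightarrow> real) \<Rightarrow> bool" where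
  "C_on m S f \<longleftrightarrow>
     (\<forall>l<m. higher_deriv_on S l f differentiable_on S) \<and>
     continuous_on S (higher_deriv_on S m f)"

text \<open>
  Both schemes are run on arbitrary starting values \<open>g j\<close>, attached to the nodes \<open>xs j\<close>.
  The value \<open>neville xs g x i j\<close> is the entry with index list \<open>j, j+1, \<dots>, i+j\<close>.
\<close>

fun neville :: "(nat \<Rightarrow> real) \<Rightarrow> (nat \<Rightarrow> real) \<Rightarrow> real \<Rightarrow> nat \<Rightarrow> nat \<Rightarrow> real" where
  "neville xs g x 0 j = g j"
| "neville xs g x (Suc i) j =
     1 / (xs (Suc i + j) - xs j) *
     det2 (neville xs g x i j)       (xs j - x)
          (neville xs g x i (Suc j)) (xs (Suc i + j) - x)"

text \<open>
  The value \<open>aitken xs g x i j\<close> is the entry with index list \<open>0, 1, \<dots>, i-1, j\<close>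
  (just \<open>j\<close> if \<open>i = 0\<close>), so \<open>aitken xs g x i i\<close> has index list \<open>0, 1, \<dots>, i\<close>.
\<close>

fun aitken :: "(nat \<Rightarrow> real) \<Rightarrow> (nat \<Rightarrow> real) \<Rightarrow> real \<Rightarrow> nat \<Rightarrow> nat \<Rightarrow> real" where
  "aitken xs g x 0 j = g j"
| "aitken xs g x (Suc i) j =
     1 / (xs j - xs i) *
     det2 (aitken xs g x i i) (xs i - x)
          (aitken xs g x i j) (xs j - x)"

definition neville_N :: "(nat \<Rightarrow> real) \<Rightarrow> nat \<Rightarrow> nat \<Rightarrow> real \<Rightarrow> real" where
  "neville_N xs n r x = neville xs (\<lambda>j. 1 / (xs j - x) ^ r) x n 0"

definition neville_N_tilde ::
    "(real \<Rightarrow> real) \<Rightarrow> (nat \<Rightarrow> real) \<Rightarrow> nat \<Rightarrow> nat \<Rightarrow> real \<Rightarrow> real" where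
  "neville_N_tilde f xs n r x = neville xs (\<lambda>j. f (xs j) / (xs j - x) ^ r) x n 0"

definition aitken_A :: "(nat \<Rightarrow> real) \<Rightarrow> nat \<Rightarrow> nat \<Rightarrow> real \<Rightarrow> real" where
  "aitken_A xs n r x = aitken xs (\<lambda>j. 1 / (xs j - x) ^ r) x n n"

definition aitken_A_tilde ::
    "(real \<Rightarrow> real) \<Rightarrow> (nat \<Rightarrow> real) \<Rightarrow> nat \<Rightarrow> nat \<Rightarrow> real \<Rightarrow> real" where
  "aitken_A_tilde f xs n r x = aitken xs (\<lambda>j. f (xs j) / (xs j - x) ^ r) x n n"

end

theory Submission
  imports Defs
begin

text \<open>
  Both schemes compute the value at \<open>x\<close> of the Lagrange interpolation polynomial of their starting
  values. Let \<open>H\<close> be the Hermite interpolation polynomial of \<open>f\<close> with \<open>(k+1)\<close>-fold node \<open>x\<close> and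
  simple nodes \<open>x\<^sub>j\<close>, written as the Taylor polynomial of order \<open>k\<close> at \<open>x\<close> plus \<open>(t - x)\<^sup>k\<^sup>+\<^sup>1 Q(t)\<close>,
  where \<open>Q\<close> interpolates the scaled Taylor remainders. Rolle's theorem, applied \<open>n + k + 1\<close> times to
  \<open>f - H\<close>, shows that the leading coefficient of \<open>Q\<close> is \<open>f\<^sup>(\<^sup>n\<^sup>+\<^sup>k\<^sup>+\<^sup>1\<^sup>)(\<xi>) / (n + k + 1)!\<close>, while
  multiplying that coefficient by the product of all \<open>x - x\<^sub>j\<close> turns it into a combination of
  Lagrange values at \<open>x\<close>, which is the claimed formula.
\<close>

section \<open>Lagrange values and the Neville and Aitken recursions\<close>

definition lagrange_sum :: "'a set \<Rightarrow> ('a \<Rightarrow> real) \<Rightarrow> ('a \<Rightarrow> real) \<Rightarrow> real \<Rightarrow> real" where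
  "lagrange_sum I xs g x = (\<Sum>j\<in>I. g j * (\<Prod>i\<in>I - {j}. (x - xs i) / (xs j - xs i)))"

lemma det2_eq: "det2 a b c d = a * d - b * c"
  by (simp add: det_2)

lemma lagrange_sum_singleton [simp]: "lagrange_sum {j} xs g x = g j"
  by (simp add: lagrange_sum_def)

text \<open>The coefficients of each \<open>g j\<close> agree on both sides. Arbitrary index sets
  make one recursion serve both schemes: Neville takes the two end indices for \<open>a\<close> and
  \<open>b\<close>, Aitken takes \<open>i\<close> and \<open>j\<close> over
  \<open>{..<i}\<close>.\<close>

lemma lagrange_sum_insert_insert:
  assumes "finite I" "a \<notin> I" "b \<notin> I" "a \<noteq> b" and inj: "inj_on xs (insert a (insert b I))"
  shows "lagrange_sum (insert a (insert b I)) xs g x =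
    1 / (xs b - xs a) * (lagrange_sum (insert a I) xs g x * (xs b - x)
      - (xs a - x) * lagrange_sum (insert b I) xs g x)"
proof -
  let ?w = "\<lambda>I j. \<Prod>i\<in>I - {j}. (x - xs i) / (xs j - xs i)"
  have ab: "xs a \<noteq> xs b"
    using assms by (auto simp: inj_on_def)
  have expand: "lagrange_sum (insert c J) xs g x = g c * ?w J c
      + (\<Sum>j\<in>J. g j * (?w J j * ((x - xs c) / (xs j - xs c))))"
    if "finite J" "c \<notin> J" for c J
  proof -
    have "?w (insert c J) j = ?w J j * ((x - xs c) / (xs j - xs c))" if "j \<in> J" for j
    proof -
      have "insert c J - {j} = insert c (J - {j})" "c \<notin> J - {j}"
        using that \<open>c \<notin> J\<close> by auto
      then show ?thesis
        using \<open>finite J\<close> by simp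
    qed
    then show ?thesis
      using that by (simp add: lagrange_sum_def)
  qed
  define R where "R = (\<lambda>c j. (x - xs c) / (xs j - xs c))"
  have wb: "?w (insert b I) a = ?w I a * R b a"
    using assms by (simp add: R_def)
  have wI: "?w (insert b I) j = ?w I j * R b j" if "j \<in> I" for j
  proof -
    have "insert b I - {j} = insert b (I - {j})" "b \<notin> I - {j}"
      using that assms by auto
    then show ?thesis
      using assms by (simp add: R_def)
  qed
  \<comment> \<open>Partial fractions: with u = \<open>xs j - xs a\<close> and v =
    \<open>xs j - xs b\<close>, 1/(u v) = (1/v - 1/u) / (\<open>xs b - xs a\<close>).\<close>
  have split: "R b j * R a j = 1 / (xs b - xs a) * (R a j * (xs b - x) - (xs a - x) * R b j)"
    if "j \<in> I" for j
  proof -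
    have "xs j \<noteq> xs a" "xs j \<noteq> xs b"
      using that assms by (auto simp: inj_on_def)
    then show ?thesis
      using ab unfolding R_def by (simp add: divide_simps) (simp add: algebra_simps)
  qed
  have factor: "u * (w * r) = e * (u * (w * A) * s - t * (u * (w * B)))"
    if "r = e * (A * s - t * B)" for u w r e A s t B :: real
    unfolding that by (simp add: algebra_simps)
  have combine: "u * (w * (e * s)) + (v * (z * (- (e * t))) + e * (A * s - t * B))
      = e * ((u * w + A) * s - t * (v * z + B))" for u w v z e A s t B :: real
    by (simp add: algebra_simps)
  have bI: "?w (insert b I) b = ?w I b"
    using assms by simp
  have "lagrange_sum (insert a (insert b I)) xs g x
      = g a * (?w I a * R b a) + (g b * (?w I b * R a b)
        + (\<Sum>j\<in>I. g j * (?w I j * (R b j * R a j))))"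
    using assms expand[of "insert b I" a] wI wb bI by (simp add: R_def mult.assoc)
  also have "(\<Sum>j\<in>I. g j * (?w I j * (R b j * R a j)))
      = 1 / (xs b - xs a) * ((\<Sum>j\<in>I. g j * (?w I j * R a j)) * (xs b - x)
          - (xs a - x) * (\<Sum>j\<in>I. g j * (?w I j * R b j)))"
    unfolding sum_distrib_left sum_distrib_right sum_subtractf[symmetric]
    by (intro sum.cong refl factor split)
  also have "R b a = 1 / (xs b - xs a) * (xs b - x)"
    using ab by (simp add: R_def divide_simps) (simp add: algebra_simps)
  also have "R a b = - (1 / (xs b - xs a) * (xs a - x))"
    using ab by (simp add: R_def divide_simps)
  finally show ?thesis
    by (simp only: expand[OF assms(1,2)] expand[OF assms(1,3)] R_def combine)
qed

lemma neville_eq_lagrange_sum: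
  assumes "inj_on xs {j..i + j}"
  shows "neville xs g x i j = lagrange_sum {j..i + j} xs g x"
  using assms
proof (induction i arbitrary: j)
  case 0
  then show ?case by simp
next
  case (Suc i)
  have IH: "neville xs g x i j = lagrange_sum {j..i + j} xs g x"
    "neville xs g x i (Suc j) = lagrange_sum {Suc j..Suc i + j} xs g x"
    using Suc.IH[of j] Suc.IH[of "Suc j"] inj_on_subset[OF Suc.prems] by auto
  have eq: "{j..i + j} = insert j {Suc j..i + j}"
    "{Suc j..Suc i + j} = insert (Suc i + j) {Suc j..i + j}"
    "{j..Suc i + j} = insert j (insert (Suc i + j) {Suc j..i + j})"
    by auto
  show ?case
    using lagrange_sum_insert_insert[of "{Suc j..i + j}" j "Suc i + j" xs g x] Suc.prems
    unfolding neville.simps det2_eq IH unfolding eq by simp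
qed

text \<open>The bound \<open>i \<le> j\<close> keeps \<open>j\<close> out of \<open>{..<i}\<close>,
  so the index set has \<open>i + 1\<close> elements, like the index list of the entry.\<close>

lemma aitken_eq_lagrange_sum:
  assumes "inj_on xs (insert j {..<i})" "i \<le> j"
  shows "aitken xs g x i j = lagrange_sum (insert j {..<i}) xs g x"
  using assms
proof (induction i arbitrary: j)
  case 0
  then show ?case by simp
next
  case (Suc i)
  have eq: "insert j {..<Suc i} = insert i (insert j {..<i})"
    by auto
  have inj: "inj_on xs (insert i {..<i})" "inj_on xs (insert j {..<i})"
    by (rule inj_on_subset[OF Suc.prems(1)]; auto)+
  have IH: "aitken xs g x i i = lagrange_sum (insert i {..<i}) xs g x"
    "aitken xs g x i j = lagrange_sum (insert j {..<i}) xs g x"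
    using Suc.IH[OF inj(1)] Suc.IH[OF inj(2)] Suc.prems(2) by simp_all
  show ?case
    using lagrange_sum_insert_insert[of "{..<i}" i j xs g x] Suc.prems
    unfolding aitken.simps det2_eq IH eq by simp
qed

text \<open>The determinant reduces to \<open>xs (Suc i + j) - xs j\<close> and cancels the
  denominator. This gives weight 1 to the derivative of order \<open>k\<close> in the final
  formula.\<close>

lemma neville_one:
  assumes "inj_on xs {j..i + j}"
  shows "neville xs (\<lambda>j. 1) x i j = 1"
  using assms
proof (induction i arbitrary: j)
  case (Suc i)
  have "xs (Suc i + j) \<noteq> xs j"
    using inj_onD[OF Suc.prems, of "Suc i + j" j] by auto
  moreover have "neville xs (\<lambda>j. 1) x i j = 1" "neville xs (\<lambda>j. 1) x i (Suc j) = 1"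
    using inj_on_subset[OF Suc.prems] by (auto intro!: Suc.IH)
  ultimately show ?case
    by (simp add: det2_eq)
qed simp

section \<open>Counting zeros of derivatives\<close>

text \<open>Each gap between consecutive zeros contributes one zero of \<open>g'\<close>. That
  \<open>Z'\<close> avoids \<open>Z\<close> matters later: a multiple zero of \<open>g\<close> in
  \<open>Z\<close> can be added to \<open>Z'\<close> as a further zero of \<open>g'\<close>.\<close>

lemma Rolle_finite_set:
  fixes g g' :: "real \<Rightarrow> real"
  assumes "finite Z" "Z \<noteq> {}" "Z \<subseteq> {a..b}" "\<And>t. t \<in> Z \<Longrightarrow> g t = 0"
    and deriv: "\<And>t. t \<in> {a..b} \<Longrightarrow> (g has_real_derivative g' t) (at t within {a..b})"
  shows "\<exists>Z'. finite Z' \<and> card Z = Suc (card Z') \<and> Z' \<subseteq> {Min Z..Max Z} - Z \<and> (\<forall>t\<in>Z'. g' t = 0)"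
  using assms(1-4)
proof (induction rule: finite_linorder_max_induct)
  case (insert c Z)
  show ?case
  proof (cases "Z = {}")
    case True
    then show ?thesis by (intro exI[of _ "{}"]) auto
  next
    case False
    then obtain Z' where Z': "finite Z'" "card Z = Suc (card Z')" "Z' \<subseteq> {Min Z..Max Z} - Z"
      "\<forall>t\<in>Z'. g' t = 0"
      using insert.IH insert.prems by auto
    define m where "m = Max Z"
    have m: "m \<in> Z" "m < c" "\<And>z. z \<in> Z \<Longrightarrow> z \<le> m"
      using False insert.hyps by (auto simp: m_def)
    have mc: "{m..c} \<subseteq> {a..b}"
      using m insert.prems by auto
    have "\<exists>t. m < t \<and> t < c \<and> (\<lambda>h. g' t * h) = (\<lambda>h. 0)"
    proof (rule Rolle_deriv[of m c g "\<lambda>t h. g' t * h"])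
      show "continuous_on {m..c} g"
        using mc deriv by (meson DERIV_continuous continuous_on_eq_continuous_within
            continuous_on_subset)
      show "(g has_derivative (*) (g' t)) (at t)" if "m < t" "t < c" for t
      proof -
        have "(g has_real_derivative g' t) (at t within {m<..<c})"
          using that mc by (intro has_field_derivative_subset[OF deriv]) auto
        then show ?thesis
          using that by (metis at_within_open greaterThanLessThan_iff has_field_derivative_def open_greaterThanLessThan)
      qed
    qed (use m insert.prems in auto)
    then obtain t where t: "m < t" "t < c" "g' t = 0"
      by (metis mult.right_neutral)
    have "Min Z \<le> m"
      using insert.hyps m by simp
    then have mm: "Max (insert c Z) = c" "Min (insert c Z) = Min Z" "Min Z < t"
      using m(2) t(1) False insert.hyps by (simp_all add: max_absorb1 min_absorb2 flip: m_def)
    have below: "z \<le> m" if "z \<in> Z' \<union> Z" for z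
      using that Z'(3) m(3) by (auto simp: m_def)
    have "t \<notin> Z' \<union> Z" "c \<notin> Z' \<union> Z"
      using below t by force+
    moreover have "z \<le> c" if "z \<in> Z'" for z
      using below[of z] that m(2) by simp
    ultimately have "insert t Z' \<subseteq> {Min Z..c} - insert c Z"
      using Z'(3) t mm(3) by auto
    moreover have "card (insert c Z) = Suc (card (insert t Z'))"
      using \<open>t \<notin> Z' \<union> Z\<close> \<open>c \<notin> Z' \<union> Z\<close> Z'(1,2) insert.hyps by simp
    ultimately show ?thesis
      using Z' t mm by (intro exI[of _ "insert t Z'"]) auto
  qed
qed simp

text \<open>With multiplicity, \<open>G 0\<close> has (n + 1) + (k + 1) zeros, \<open>x\<close>
  counting \<open>k + 1\<close> times. Each of the \<open>n + k + 1\<close> differentiations costs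
  one zero, so one is left.\<close>

lemma Rolle_multiple:
  fixes G :: "nat \<Rightarrow> real \<Rightarrow> real"
  assumes Z: "finite Z" "Z \<subseteq> {a..b}" "card Z = Suc n" "x \<notin> Z" "x \<in> {a..b}"
    and zero: "\<And>z. z \<in> Z \<Longrightarrow> G 0 z = 0" "\<And>l. l \<le> k \<Longrightarrow> G l x = 0"
    and deriv: "\<And>l t. l \<le> n + k \<Longrightarrow> t \<in> {a..b} \<Longrightarrow>
      (G l has_real_derivative G (Suc l) t) (at t within {a..b})"
  shows "\<exists>\<xi>\<in>{a..b}. G (n + k + 1) \<xi> = 0"
proof -
  have step: "\<exists>Z'. finite Z' \<and> card Y = Suc (card Z') \<and> Z' \<subseteq> {a..b} - Y \<and> (\<forall>t\<in>Z'. G (Suc l) t = 0)"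
    if "finite Y" "Y \<noteq> {}" "Y \<subseteq> {a..b}" "\<And>t. t \<in> Y \<Longrightarrow> G l t = 0" "l \<le> n + k" for Y l
  proof -
    have "{Min Y..Max Y} \<subseteq> {a..b}"
      using that Min_in[of Y] Max_in[of Y] by (meson atLeastAtMost_iff atLeastatMost_subset_iff subsetD)
    then show ?thesis
      using Rolle_finite_set[of Y a b "G l" "G (Suc l)"] that deriv by blast
  qed
  \<comment> \<open>Adding the zero \<open>x\<close> gives \<open>n + 2\<close> zeros; Rolle turns
    them into \<open>n + 1\<close> new ones, all different from \<open>x\<close>, so the count is
    stable up to order \<open>k\<close>.\<close>
  have low: "\<exists>Y. finite Y \<and> card Y = n + 1 \<and> Y \<subseteq> {a..b} \<and> x \<notin> Y \<and> (\<forall>t\<in>Y. G l t = 0)"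
    if "l \<le> k" for l
    using that
  proof (induction l)
    case 0
    then show ?case using Z zero by auto
  next
    case (Suc l)
    then obtain Y where Y: "finite Y" "card Y = n + 1" "Y \<subseteq> {a..b}" "x \<notin> Y" "\<forall>t\<in>Y. G l t = 0"
      by auto
    then obtain Y' where "finite Y'" "card (insert x Y) = Suc (card Y')" "Y' \<subseteq> {a..b} - insert x Y"
      "\<forall>t\<in>Y'. G (Suc l) t = 0"
      using step[of "insert x Y" l] zero(2)[of l] Z Suc.prems by auto
    then show ?case
      using Y by (intro exI[of _ Y']) auto
  qed
  \<comment> \<open>From order \<open>k\<close> on, \<open>x\<close> has been added for the last
    time and every derivative loses one zero.\<close>
  have high: "\<exists>Y. finite Y \<and> card Y + m = n + 2 \<and> Y \<subseteq> {a..b} \<and> (\<forall>t\<in>Y. G (k + m) t = 0)"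
    if "m \<le> n + 1" for m
    using that
  proof (induction m)
    case 0
    obtain Y where "finite Y" "card Y = n + 1" "Y \<subseteq> {a..b}" "x \<notin> Y" "\<forall>t\<in>Y. G k t = 0"
      using low by blast
    then show ?case
      using zero(2)[of k] Z by (intro exI[of _ "insert x Y"]) auto
  next
    case (Suc m)
    then obtain Y where Y: "finite Y" "card Y + m = n + 2" "Y \<subseteq> {a..b}" "\<forall>t\<in>Y. G (k + m) t = 0"
      by auto
    moreover have "Y \<noteq> {}"
      using Y Suc.prems by auto
    ultimately obtain Y' where "finite Y'" "card Y = Suc (card Y')" "Y' \<subseteq> {a..b}"
      "\<forall>t\<in>Y'. G (Suc (k + m)) t = 0"
      using step[of Y "k + m"] Suc.prems by auto
    then show ?case
      using Y by (intro exI[of _ Y']) auto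
  qed
  obtain Y where "card Y = 1" "Y \<subseteq> {a..b}" "\<forall>t\<in>Y. G (k + (n + 1)) t = 0"
    using high[of "n + 1"] by auto
  then show ?thesis
    by (auto simp: card_1_singleton_iff add_ac)
qed

section \<open>Hermite interpolation and its leading coefficient\<close>

text \<open>In Lagrange form the basis polynomials \<open>B j\<close> are monic of degree
  \<open>n\<close> before scaling, so the coefficient of order \<open>n\<close>, a divided
  difference, can be read off.\<close>

lemma interpolating_polynomial:
  fixes y g :: "'a \<Rightarrow> real"
  assumes "finite I" "card I = Suc n" "inj_on y I"
  obtains Q :: "real poly" where "degree Q \<le> n" "\<And>j. j \<in> I \<Longrightarrow> poly Q (y j) = g j"
    "coeff Q n = (\<Sum>j\<in>I. g j / (\<Prod>i\<in>I - {j}. y j - y i))"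
proof
  define B where "B = (\<lambda>j. \<Prod>i\<in>I - {j}. [:- y i, 1:])"
  define Q where "Q = (\<Sum>j\<in>I. smult (g j / (\<Prod>i\<in>I - {j}. y j - y i)) (B j))"
  have B_deg: "degree (B j) = n" and B_coeff: "coeff (B j) n = 1" if "j \<in> I" for j
  proof -
    show deg: "degree (B j) = n"
      using assms that unfolding B_def by (subst degree_prod_eq_sum_degree) auto
    have "lead_coeff (B j) = 1"
      unfolding B_def lead_coeff_prod by simp
    then show "coeff (B j) n = 1"
      by (simp add: deg)
  qed
  show "degree Q \<le> n"
    unfolding Q_def using B_deg by (intro degree_sum_le assms) (auto intro: order.trans[OF degree_smult_le])
  show "coeff Q n = (\<Sum>j\<in>I. g j / (\<Prod>i\<in>I - {j}. y j - y i))"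
    unfolding Q_def coeff_sum by (simp add: B_coeff)
  show "poly Q (y j) = g j" if "j \<in> I" for j
  proof -
    have "poly Q (y j) = (\<Sum>l\<in>I. if l = j then g j else 0)"
      unfolding Q_def poly_sum
    proof (intro sum.cong refl)
      fix l assume "l \<in> I"
      have "poly (B l) (y j) = (\<Prod>i\<in>I - {l}. y j - y i)"
        by (simp add: B_def poly_prod)
      moreover have "(\<Prod>i\<in>I - {l}. y j - y i) = 0" if "l \<noteq> j"
        using that \<open>j \<in> I\<close> assms(1) by auto
      moreover have "(\<Prod>i\<in>I - {j}. y j - y i) \<noteq> 0"
        using assms \<open>j \<in> I\<close> by (auto simp: inj_on_def)
      ultimately show "poly (smult (g l / (\<Prod>i\<in>I - {l}. y l - y i)) (B l)) (y j) = (if l = j then g j else 0)"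
        by auto
    qed
    then show ?thesis
      using that assms by simp
  qed
qed

lemma higher_pderiv_pcompose_shift:
  "(pderiv ^^ m) (pcompose P [:c, 1:]) = pcompose ((pderiv ^^ m) P) [:c, 1 :: real:]"
  by (induction m) (simp_all add: pderiv_pcompose pderiv_pCons)

lemma higher_deriv_on_has_derivative:
  assumes "C_on m S f" "l < m" "t \<in> S" "S = {a..b}" "a < b"
  shows "(higher_deriv_on S l f has_real_derivative higher_deriv_on S (Suc l) f t) (at t within S)"
proof -
  have "higher_deriv_on S l f differentiable at t within S"
    using assms by (auto simp: C_on_def differentiable_on_def)
  then show ?thesis
    by (simp add: higher_deriv_on_def has_real_derivative_iff_has_vector_derivative
        vector_derivative_works)
qed

text \<open>
  The number \<open>c\<close> is the divided difference of \<open>f\<close> at the \<open>x\<^sub>j\<close> and the \<open>(k+1)\<close>-fold node \<open>x\<close>,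
  that is, the leading coefficient of the Hermite interpolation polynomial.
\<close>

lemma hermite_divided_difference:
  fixes xs :: "'a \<Rightarrow> real" and F :: "nat \<Rightarrow> real \<Rightarrow> real"
  assumes I: "finite I" "card I = Suc n" "inj_on xs I" "x \<notin> xs ` I" "x \<in> {a..b}" "xs ` I \<subseteq> {a..b}"
    and deriv: "\<And>l t. l \<le> n + k \<Longrightarrow> t \<in> {a..b} \<Longrightarrow>
      (F l has_real_derivative F (Suc l) t) (at t within {a..b})"
  defines "c \<equiv> \<Sum>j\<in>I. (F 0 (xs j) - (\<Sum>m\<le>k. F m x / fact m * (xs j - x) ^ m))
      / (xs j - x) ^ Suc k / (\<Prod>i\<in>I - {j}. xs j - xs i)"
  shows "\<exists>\<xi>\<in>{a..b}. F (n + k + 1) \<xi> / fact (n + k + 1) = c"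
proof -
  define g where "g = (\<lambda>j. (F 0 (xs j) - (\<Sum>m\<le>k. F m x / fact m * (xs j - x) ^ m)) / (xs j - x) ^ Suc k)"
  have "inj_on (\<lambda>j. xs j - x) I"
    using I by (auto simp: inj_on_def)
  then obtain Q where Q: "degree Q \<le> n" "\<And>j. j \<in> I \<Longrightarrow> poly Q (xs j - x) = g j" "coeff Q n = c"
    using interpolating_polynomial[of I n "\<lambda>j. xs j - x" g] I by (auto simp: c_def g_def)
  \<comment> \<open>\<open>P\<close> is the Hermite interpolant in the variable
    \<open>t - x\<close>. The factor of \<open>Q\<close> vanishes to order \<open>k + 1\<close> at
    0, so it leaves the Taylor coefficients alone and moves the coefficient \<open>c\<close> of
    \<open>Q\<close> to order \<open>n + k + 1\<close>.\<close>
  define P where "P = (\<Sum>m\<le>k. monom (F m x / fact m) m) + monom 1 (Suc k) * Q"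
  have coeff_low: "coeff P m = F m x / fact m" if "m \<le> k" for m
    using that by (simp add: P_def coeff_sum coeff_monom_mult)
  have coeff_top: "coeff P (n + k + 1) = c"
    using Q by (simp add: P_def coeff_sum coeff_monom_mult)
  \<comment> \<open>Hence the derivative of order \<open>n + k + 1\<close> is a constant, which a
    zero of \<open>G (n + k + 1)\<close> equates with the derivative of \<open>F 0\<close>.\<close>
  have "degree P \<le> n + k + 1"
    unfolding P_def using Q
    by (intro degree_add_le degree_sum_le order.trans[OF degree_monom_le] order.trans[OF degree_mult_le])
       (auto simp: degree_monom_eq)
  then have "degree ((pderiv ^^ (n + k + 1)) P) = 0"
    by (subst degree_higher_pderiv) simp
  then obtain d where d: "(pderiv ^^ (n + k + 1)) P = [:d:]"
    by (metis degree_eq_zeroE)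
  have "coeff ((pderiv ^^ (n + k + 1)) P) 0 = fact (n + k + 1) * c"
    using coeff_top by (subst coeff_higher_pderiv) (simp add: pochhammer_fact)
  then have top: "(pderiv ^^ (n + k + 1)) P = [:fact (n + k + 1) * c:]"
    using d by simp
  define H where "H = pcompose P [:- x, 1:]"
  define G where "G = (\<lambda>l t. F l t - poly ((pderiv ^^ l) H) t)"
  have "\<exists>\<xi>\<in>{a..b}. G (n + k + 1) \<xi> = 0"
  proof (rule Rolle_multiple[of "xs ` I" a b n x])
    show "card (xs ` I) = Suc n"
      using I by (simp add: card_image)
    show "G l x = 0" if "l \<le> k" for l
      using coeff_low[OF that]
      by (simp add: G_def H_def higher_pderiv_pcompose_shift poly_pcompose poly_0_coeff_0
          coeff_higher_pderiv flip: pochhammer_fact)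
    show "G 0 z = 0" if z: "z \<in> xs ` I" for z
    proof -
      obtain j where j: "z = xs j" "j \<in> I"
        using z by auto
      then have "z \<noteq> x"
        using I by auto
      then have "poly H z = F 0 z"
        using Q(2)[OF j(2)] by (simp add: H_def P_def poly_pcompose poly_sum poly_monom g_def j)
      then show ?thesis
        by (simp add: G_def)
    qed
    show "(G l has_real_derivative G (Suc l) t) (at t within {a..b})" if "l \<le> n + k" "t \<in> {a..b}" for l t
      unfolding G_def
      using deriv[OF that] has_field_derivative_at_within[OF poly_DERIV[of "(pderiv ^^ l) H" t]]
      by (auto intro: DERIV_diff)
  qed (use I in auto)
  then obtain \<xi> where "\<xi> \<in> {a..b}" "F (n + k + 1) \<xi> = fact (n + k + 1) * c"
    unfolding G_def H_def higher_pderiv_pcompose_shift top by (auto simp: pcompose_const)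
  then show ?thesis
    by (intro bexI[of _ \<xi>]) (simp_all del: fact_Suc add_Suc_right One_nat_def)
qed

text \<open>The nodal product turns the reciprocal of each node product into
  \<open>(x - xs j) * L j\<close>. Its first factor cancels one power of \<open>xs j - x\<close> and
  flips the sign, so the Taylor part comes out positive and \<open>h\<close> negative.\<close>

lemma hermite_divided_difference_mult_nodal:
  fixes xs :: "'a \<Rightarrow> real" and d :: "nat \<Rightarrow> real"
  assumes "finite I" "inj_on xs I" "x \<notin> xs ` I"
  shows "(\<Sum>j\<in>I. (h j - (\<Sum>m\<le>k. d m * (xs j - x) ^ m)) / (xs j - x) ^ Suc k
        / (\<Prod>i\<in>I - {j}. xs j - xs i)) * (\<Prod>i\<in>I. x - xs i)
    = (\<Sum>r\<le>k. d (k - r) * lagrange_sum I xs (\<lambda>j. 1 / (xs j - x) ^ r) x)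
      - lagrange_sum I xs (\<lambda>j. h j / (xs j - x) ^ k) x"
proof -
  define L where "L = (\<lambda>j. \<Prod>i\<in>I - {j}. (x - xs i) / (xs j - xs i))"
  have "(h j - (\<Sum>m\<le>k. d m * (xs j - x) ^ m)) / (xs j - x) ^ Suc k
        / (\<Prod>i\<in>I - {j}. xs j - xs i) * (\<Prod>i\<in>I. x - xs i)
      = (\<Sum>r\<le>k. d (k - r) * (1 / (xs j - x) ^ r * L j)) - h j / (xs j - x) ^ k * L j"
    if j: "j \<in> I" for j
  proof -
    have nz: "xs j - x \<noteq> 0"
      using j assms by auto
    \<comment> \<open>Reversing the order by \<open>r = k - m\<close> turns the Taylor powers into
      the reciprocal powers that start the schemes.\<close>
    have "(\<Sum>m\<le>k. d m * (xs j - x) ^ m) / (xs j - x) ^ k = (\<Sum>r\<le>k. d (k - r) * (1 / (xs j - x) ^ r))"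
      unfolding sum_divide_distrib
      by (rule sum.reindex_bij_witness[of _ "\<lambda>r. k - r" "\<lambda>r. k - r"])
        (use nz in \<open>auto simp: power_diff\<close>)
    then have taylor: "(\<Sum>m\<le>k. d m * (xs j - x) ^ m) / (xs j - x) ^ k * L j
        = (\<Sum>r\<le>k. d (k - r) * (1 / (xs j - x) ^ r * L j))"
      by (simp add: sum_distrib_right mult.assoc)
    have "(\<Prod>i\<in>I. x - xs i) / (\<Prod>i\<in>I - {j}. xs j - xs i) = (x - xs j) * L j"
      using j assms by (simp add: L_def prod.remove prod_dividef)
    also have "\<dots> = - (xs j - x) * L j"
      by simp
    finally have "e / (\<Prod>i\<in>I - {j}. xs j - xs i) * (\<Prod>i\<in>I. x - xs i) = e * (- (xs j - x) * L j)" for e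
      by (simp only: times_divide_eq_left times_divide_eq_right[symmetric])
    moreover have "(u - v) / y ^ Suc k * (- y * w) = v / y ^ k * w - u / y ^ k * w"
      if "y \<noteq> 0" for u v w y :: real
      using that by (simp add: divide_simps) (simp add: algebra_simps)
    ultimately show ?thesis
      using nz unfolding taylor[symmetric] by presburger
  qed
  then have "(\<Sum>j\<in>I. (h j - (\<Sum>m\<le>k. d m * (xs j - x) ^ m)) / (xs j - x) ^ Suc k
        / (\<Prod>i\<in>I - {j}. xs j - xs i)) * (\<Prod>i\<in>I. x - xs i)
      = (\<Sum>j\<in>I. \<Sum>r\<le>k. d (k - r) * (1 / (xs j - x) ^ r * L j)) - (\<Sum>j\<in>I. h j / (xs j - x) ^ k * L j)"
    by (simp add: sum_distrib_right sum_subtractf)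
  moreover have "lagrange_sum I xs u x = (\<Sum>j\<in>I. u j * L j)" for u
    by (simp add: lagrange_sum_def L_def)
  ultimately show ?thesis
    by (simp only: sum_distrib_left sum.swap[of _ "{..k}"])
qed

section \<open>Error formulas for both schemes\<close>

theorem theorem4p1:
  fixes n k :: nat and p q x :: real and xs :: "nat \<Rightarrow> real" and f :: "real \<Rightarrow> real"
  assumes "x \<in> {p..q}"
    and "\<And>j. j \<le> n \<Longrightarrow> xs j \<in> {p..q}"
    and "inj_on xs {0..n}"
    and "x \<notin> xs ` {0..n}"
    and "C_on (n + k + 1) {p..q} f"
  shows "\<exists>\<xi> \<in> {Min (insert x (xs ` {0..n})) .. Max (insert x (xs ` {0..n}))}.
      higher_deriv_on {p..q} k f x / fact k
        + (\<Sum>r = 1..k. higher_deriv_on {p..q} (k - r) f x / fact (k - r) * neville_N xs n r x)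
      = neville_N_tilde f xs n k x
        + higher_deriv_on {p..q} (n + k + 1) f \<xi> / fact (n + k + 1) * (\<Prod>i = 0..n. x - xs i)
    \<and> higher_deriv_on {p..q} k f x / fact k
        + (\<Sum>r = 1..k. higher_deriv_on {p..q} (k - r) f x / fact (k - r) * aitken_A xs n r x)
      = aitken_A_tilde f xs n k x
        + higher_deriv_on {p..q} (n + k + 1) f \<xi> / fact (n + k + 1) * (\<Prod>i = 0..n. x - xs i)"
proof -
  let ?I = "{0..n}" and ?F = "\<lambda>l. higher_deriv_on {p..q} l f"
  \<comment> \<open>Rolle is applied on the hull of the points to localize \<open>\<xi>\<close>,
    while the derivatives remain those within \<open>{p..q}\<close>.\<close>
  define a where "a = Min (insert x (xs ` ?I))"
  define b where "b = Max (insert x (xs ` ?I))"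
  have ab: "x \<in> {a..b}" "xs ` ?I \<subseteq> {a..b}" "{a..b} \<subseteq> {p..q}"
  proof -
    show "x \<in> {a..b}" "xs ` ?I \<subseteq> {a..b}"
      unfolding a_def b_def by (auto simp del: Min_insert Max_insert intro!: Min_le Max_ge)
    have "a \<in> insert x (xs ` ?I)" "b \<in> insert x (xs ` ?I)"
      unfolding a_def b_def by (intro Min_in Max_in; simp)+
    then show "{a..b} \<subseteq> {p..q}"
      using assms(1,2) by auto
  qed
  \<comment> \<open>Two distinct points show that \<open>{p..q}\<close> is nondegenerate.\<close>
  have "xs 0 \<noteq> x" "xs 0 \<in> {p..q}"
    using assms(2)[of 0] assms(4) by auto
  then have "p < q"
    using assms(1) by auto
  have "\<exists>\<xi>\<in>{a..b}. ?F (n + k + 1) \<xi> / fact (n + k + 1) =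
      (\<Sum>j\<in>?I. (?F 0 (xs j) - (\<Sum>m\<le>k. ?F m x / fact m * (xs j - x) ^ m))
        / (xs j - x) ^ Suc k / (\<Prod>i\<in>?I - {j}. xs j - xs i))"
  proof (rule hermite_divided_difference)
    show "(?F l has_real_derivative ?F (Suc l) t) (at t within {a..b})"
      if "l \<le> n + k" "t \<in> {a..b}" for l t
      using higher_deriv_on_has_derivative[OF assms(5), of l t] that ab \<open>p < q\<close>
      by (auto intro: has_field_derivative_subset)
  qed (use assms ab in auto)
  then obtain \<xi> where \<xi>: "\<xi> \<in> {a..b}" and "?F (n + k + 1) \<xi> / fact (n + k + 1) =
      (\<Sum>j\<in>?I. (?F 0 (xs j) - (\<Sum>m\<le>k. ?F m x / fact m * (xs j - x) ^ m))
        / (xs j - x) ^ Suc k / (\<Prod>i\<in>?I - {j}. xs j - xs i))" ..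
  then have main: "?F (n + k + 1) \<xi> / fact (n + k + 1) * (\<Prod>i\<in>?I. x - xs i)
      = (\<Sum>r\<le>k. ?F (k - r) x / fact (k - r) * lagrange_sum ?I xs (\<lambda>j. 1 / (xs j - x) ^ r) x)
        - lagrange_sum ?I xs (\<lambda>j. f (xs j) / (xs j - x) ^ k) x"
    using hermite_divided_difference_mult_nodal[of ?I xs x "\<lambda>j. f (xs j)" "\<lambda>m. ?F m x / fact m" k] assms(3,4)
    by (simp add: higher_deriv_on_def)
  \<comment> \<open>Both schemes yield the same Lagrange values, so a single \<open>\<xi>\<close>
    serves both formulas.\<close>
  have N: "neville xs g x n 0 = lagrange_sum ?I xs g x" for g
    using neville_eq_lagrange_sum[of xs 0 n g x] assms(3) by simp
  have "insert n {..<n} = ?I"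
    by auto
  then have A: "aitken xs g x n n = lagrange_sum ?I xs g x" for g
    using aitken_eq_lagrange_sum[of xs n n g x] assms(3) by simp
  \<comment> \<open>The term \<open>r = 0\<close> has constant starting values 1; it splits off as
    the unweighted derivative of order \<open>k\<close>.\<close>
  have "lagrange_sum ?I xs (\<lambda>j. 1) x = 1"
    using neville_one[of xs 0 n x] assms(3) N[of "\<lambda>j. 1"] by simp
  moreover have "{..k} = insert 0 {1..k}"
    by auto
  ultimately have "?F k x / fact k
        + (\<Sum>r = 1..k. ?F (k - r) x / fact (k - r) * lagrange_sum ?I xs (\<lambda>j. 1 / (xs j - x) ^ r) x)
      = lagrange_sum ?I xs (\<lambda>j. f (xs j) / (xs j - x) ^ k) x
        + ?F (n + k + 1) \<xi> / fact (n + k + 1) * (\<Prod>i = 0..n. x - xs i)"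
    using main by simp
  then show ?thesis
    using \<xi> unfolding neville_N_def neville_N_tilde_def aitken_A_def aitken_A_tilde_def N A a_def b_def
    by blast
qed

end
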